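(* Consider the full parametric model with transfer function written in terms of its subsystems as $$\mathcal{H}(s;\mathsf{p})=\mathcal{H}_1(s)-\mathcal{H}_2(s)D(\mathsf{p})[I+D(\mathsf{p})\mathcal{H}_3(s)D(\mathsf{p})]^{-1}D(\mathsf{p})\mathcal{H}_4(s),$$ where the subsystems $\mathcal{H}_1(s)$, $\mathcal{H}_2(s)$ and $\mathcal{H}_4(s)$ are asymptotically stable, and assume that $\mathcal{H}_3(s)$ is positive real. Let the reduced subsystems $\widehat{\mathcal{H}}_1(s)$, $\widehat{\mathcal{H}}_2(s)$ and $\widehat{\mathcal{H}}_4(s)$ be constructed such that they retain asymptotic stability (i.e. are asymptotically stable), and $\widehat{\mathcal{H}}_3(s)$ such that it retains positive-realness (i.e. is positive real). Then the reduced parametric model $$\widehat{\mathcal{H}}(s;\mathsf{p})=\widehat{\mathcal{H}}_1(s)-\widehat{\mathcal{H}}_2(s)D(\mathsf{p})\bigl(I+D(\mathsf{p})\widehat{\mathcal{H}}_3(s)D(\mathsf{p})\bigr)^{-1}D(\mathsf{p})\widehat{\mathcal{H}}_4(s)$$ is uniformly asymptotically stable, i.e. asymptotically stable for every $\mathsf{p}\in\Omega$.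
   Context: Let $E,A_0\in\mathbb{R}^{n\times n}$ with $E$ invertible, $B\in\mathbb{R}^{n\times m}$, $C\in\mathbb{R}^{\ell\times n}$, $U,V\in\mathbb{R}^{n\times k}$. The parameter domain is $\Omega\subseteq\mathbb{R}^k$, with parameter vectors $\mathsf{p}=[p_1,\dots,p_k]^T$ having entries $p_i\ge0$, and $D(\mathsf{p})=\mathrm{diag}(\sqrt{p_1},\dots,\sqrt{p_k})$. The subsystems are $\mathcal{H}_1(s)=C(sE-A_0)^{-1}B$, $\mathcal{H}_2(s)=C(sE-A_0)^{-1}U$, $\mathcal{H}_3(s)=V^T(sE-A_0)^{-1}U$, $\mathcal{H}_4(s)=V^T(sE-A_0)^{-1}B$; the displayed form of $\mathcal{H}(s;\mathsf{p})$ equals $C(sE-(A_0-U\,\mathrm{diag}(p_1,\dots,p_k)V^T))^{-1}B$. The reduced subsystems $\widehat{\mathcal{H}}_i(s)$ are transfer functions of finite-dimensional real linear time-invariant systems (proper rational matrix functions with real coefficients) of the same input/output sizes as $\mathcal{H}_i(s)$. A rational transfer function is asymptotically stable if all its poles have negative real parts. A $k\times k$ real rational transfer function $\mathcal{G}(s)$ is positive real if $\mathrm{Re}(\mathcal{G}(s))\ge0$ for all $s$ with $\mathrm{Re}(s)\ge0$ (where $s$ is not a pole), where for a matrix $\mathrm{Re}(M)=\tfrac12(M+M^* )$ and $\ge0$ means positive semidefinite. A parametric model is uniformly asymptotically stable (over $\Omega$) if it is asymptotically stable for every $\mathsf{p}\in\Omega$. *)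

theory Defs
  imports
    "HOL-Complex_Analysis.Complex_Analysis"
    "HOL-Computational_Algebra.Computational_Algebra"
    "HOL-Computational_Algebra.Field_as_Ring"
begin

(* A real rational matrix function is a matrix over the field of fractions of real poly, so that
   inverses such as that of s E - A are taken in the field of rational functions and cancelled
   factors create neither poles nor spurious values. *)

type_synonym ratfun = "real poly fract"

definition rat_const :: "real \<Rightarrow> ratfun" where
  "rat_const c = to_fract [:c:]"

definition rat_var :: ratfun where
  "rat_var = to_fract [:0, 1:]"

(* The pair returned by quot_of_fract is coprime; hence the quotient below is the value of the
   rational function at every s that is not a pole, and is 0 at a pole. *)
definition rat_eval :: "ratfun \<Rightarrow> complex \<Rightarrow> complex" where
  "rat_eval f s = (case quot_of_fract f of (p, q) \<Rightarrow>
     poly (map_poly of_real p) s / poly (map_poly of_real q) s)"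

definition rat_proper :: "ratfun \<Rightarrow> bool" where
  "rat_proper f \<longleftrightarrow> (case quot_of_fract f of (p, q) \<Rightarrow> degree p \<le> degree q)"

definition const_mat :: "real^'b^'a \<Rightarrow> ratfun^'b^'a" where
  "const_mat M = map_matrix rat_const M"

definition proper_mat :: "ratfun^'b^'a \<Rightarrow> bool" where
  "proper_mat G \<longleftrightarrow> (\<forall>i j. rat_proper (G $ i $ j))"

definition eval_mat :: "ratfun^'b^'a \<Rightarrow> complex \<Rightarrow> complex^'b^'a" where
  "eval_mat G s = map_matrix (\<lambda>f. rat_eval f s) G"

definition mat_pole :: "ratfun^'b^'a \<Rightarrow> complex \<Rightarrow> bool" where
  "mat_pole G s \<longleftrightarrow> (\<exists>i j. is_pole (\<lambda>z. eval_mat G z $ i $ j) s)"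

definition asymptotically_stable :: "ratfun^'b^'a \<Rightarrow> bool" where
  "asymptotically_stable G \<longleftrightarrow> (\<forall>s. mat_pole G s \<longrightarrow> Re s < 0)"

definition uniformly_asymptotically_stable ::
    "(real^'k) set \<Rightarrow> (real^'k \<Rightarrow> ratfun^'b^'a) \<Rightarrow> bool" where
  "uniformly_asymptotically_stable \<Omega> G \<longleftrightarrow> (\<forall>p\<in>\<Omega>. asymptotically_stable (G p))"

definition conj_transpose :: "complex^'b^'a \<Rightarrow> complex^'a^'b" where
  "conj_transpose M = map_matrix cnj (transpose M)"

definition Re_mat :: "complex^'k^'k \<Rightarrow> complex^'k^'k" where
  "Re_mat M = (1/2) *\<^sub>R (M + conj_transpose M)"

definition pos_semidef :: "complex^'k^'k \<Rightarrow> bool" where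
  "pos_semidef M \<longleftrightarrow> conj_transpose M = M \<and>
     (\<forall>x. 0 \<le> Re (\<Sum>i\<in>UNIV. cnj (x $ i) * (M *v x) $ i))"

definition positive_real :: "ratfun^'k^'k \<Rightarrow> bool" where
  "positive_real G \<longleftrightarrow>
     (\<forall>s. Re s \<ge> 0 \<longrightarrow> \<not> mat_pole G s \<longrightarrow> pos_semidef (Re_mat (eval_mat G s)))"

definition resolvent :: "real^'n^'n \<Rightarrow> real^'n^'n \<Rightarrow> ratfun^'n^'n" where
  "resolvent E A = matrix_inv (mat rat_var ** const_mat E - const_mat A)"

definition transfer_function ::
    "real^'n^'l \<Rightarrow> real^'n^'n \<Rightarrow> real^'n^'n \<Rightarrow> real^'m^'n \<Rightarrow> ratfun^'m^'l" where
  "transfer_function C E A B = const_mat C ** resolvent E A ** const_mat B"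

definition diag :: "'a::zero^'k \<Rightarrow> 'a^'k^'k" where
  "diag v = (\<chi> i j. if i = j then v $ i else 0)"

definition D_mat :: "real^'k \<Rightarrow> ratfun^'k^'k" where
  "D_mat p = const_mat (diag (\<chi> i. sqrt (p $ i)))"

definition parametric_model ::
    "ratfun^'m^'l \<Rightarrow> ratfun^'k^'l \<Rightarrow> ratfun^'k^'k \<Rightarrow> ratfun^'m^'k \<Rightarrow> real^'k \<Rightarrow> ratfun^'m^'l" where
  "parametric_model H1 H2 H3 H4 p =
     H1 - H2 ** D_mat p ** matrix_inv (mat 1 + D_mat p ** H3 ** D_mat p) ** D_mat p ** H4"

end

theory Submission
  imports Defs
begin

text \<open>
  The feedback factor \<open>F = I + D \<H>\<^sub>3 D\<close>, with \<open>\<H>\<^sub>3\<close> positive real and \<open>D\<close> real and diagonal,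
  satisfies \<open>Re \<langle>x, F(s) x\<rangle> = \<bar>x\<bar>\<^sup>2 + Re \<langle>D x, \<H>\<^sub>3(s) (D x)\<rangle> \<ge> \<bar>x\<bar>\<^sup>2\<close> at every \<open>s\<close> of the closed right
  half plane that is not a pole of \<open>\<H>\<^sub>3\<close>. By Cauchy-Schwarz \<open>\<bar>x\<bar> \<le> \<bar>F(s) x\<bar>\<close>
  (\<open>coercive_norm_le\<close>). Two consequences follow.

  The matrix \<open>F\<close> is invertible over the field of rational functions
  (\<open>invertible_of_frequently_coercive\<close>): evaluating a nonzero kernel vector at one such \<open>s\<close>
  where it does not vanish would contradict the inequality. And the entries of \<open>F(s)\<inverse>\<close> are bounded
  by \<open>1\<close> wherever both matrices can be evaluated in the closed right half plane.
  A rational function grows without bound near each of its poles, and every \<open>s\<^sub>0\<close> with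
  \<open>Re s\<^sub>0 \<ge> 0\<close> is a limit of good points \<open>s\<^sub>0 + t\<close>, \<open>t > 0\<close>; hence \<open>F\<inverse>\<close> has no pole in the closed
  right half plane (\<open>mat_regular_matrix_inv\<close>). The limit argument covers also the points where \<open>\<H>\<^sub>3\<close>
  itself has a pole, for instance an undamped mode on the imaginary axis.

  Sums and products of matrices without poles at \<open>s\<^sub>0\<close> have no pole at \<open>s\<^sub>0\<close>, and so the
  stability of the other three subsystems carries over to the parametric model.
\<close>

section \<open>Evaluation of rational functions\<close>

abbreviation ceval :: "real poly \<Rightarrow> complex \<Rightarrow> complex" where
  "ceval p s \<equiv> poly (map_poly of_real p) s"

lemma ceval_add: "ceval (p + q) s = ceval p s + ceval q s"
proof -
  have "map_poly complex_of_real (p + q) = map_poly of_real p + map_poly of_real q"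
    by (rule poly_eqI) (simp add: coeff_map_poly)
  then show ?thesis by simp
qed

lemma ceval_smult: "ceval (smult c p) s = of_real c * ceval p s"
proof -
  have "map_poly complex_of_real (smult c p) = smult (of_real c) (map_poly of_real p)"
    by (rule poly_eqI) (simp add: coeff_map_poly)
  then show ?thesis by simp
qed

lemma ceval_mult: "ceval (p * q) s = ceval p s * ceval q s"
  by (induction p) (simp_all add: ceval_add ceval_smult map_poly_pCons algebra_simps)

lemma map_poly_of_real_eq_0_iff: "map_poly complex_of_real p = 0 \<longleftrightarrow> p = 0"
  by (simp add: map_poly_eq_0_iff)

definition rat_regular :: "ratfun \<Rightarrow> complex \<Rightarrow> bool" where
  "rat_regular f s \<longleftrightarrow> ceval (snd (quot_of_fract f)) s \<noteq> 0"

lemma ratfun_cases: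
  obtains p q where "quot_of_fract f = (p, q)" "q \<noteq> 0" "coprime p q"
    "f = to_fract p / to_fract (q :: real poly)"
proof -
  obtain p q where pq: "quot_of_fract f = (p, q)"
    by fastforce
  have "f = Fract p q"
    using quot_to_fract_quot_of_fract[of f] pq by (simp add: quot_to_fract_def)
  then have "f = to_fract p / to_fract q"
    by (simp add: Fract_conv_to_fract)
  moreover have "q \<noteq> 0"
    using snd_quot_of_fract_nonzero[of f] pq by simp
  moreover have "coprime p q"
    using coprime_quot_of_fract[of f] pq by simp
  ultimately show ?thesis
    using that pq by blast
qed

text \<open>Coprimality over the reals gives a Bezout identity, which survives evaluation at complex
  points; it therefore excludes common complex zeros as well.\<close>

lemma coprime_no_common_zero:
  assumes "coprime p q" "ceval p s = 0"
  shows "ceval q s \<noteq> 0"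
proof
  assume q: "ceval q s = 0"
  obtain a b where "a * p + b * q = 1"
    using assms(1) bezout_coefficients_fst_snd[of p q] by (metis coprime_imp_gcd_eq_1)
  then have "ceval (a * p + b * q) s = 1"
    by simp
  then show False
    using assms(2) q by (simp add: ceval_add ceval_mult)
qed

text \<open>Any representation as a quotient whose denominator does not vanish may be used for evaluation,
  reduced or not. All compatibility with the field operations comes from this.\<close>

lemma rat_eval_quotient:
  assumes f: "f = to_fract p / to_fract q" and q: "ceval q s \<noteq> 0"
  shows "rat_regular f s" "rat_eval f s = ceval p s / ceval q s"
proof -
  obtain a b where ab: "quot_of_fract f = (a, b)" "b \<noteq> 0" "coprime a b"
    "f = to_fract a / to_fract b"
    by (rule ratfun_cases)
  have "q \<noteq> 0"
    using q by auto
  then have "to_fract (p * b) = to_fract (a * q)"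
    using f ab(2,4) by (simp add: field_simps)
  then have "p * b = a * q"
    by (simp only: to_fract_eq_iff)
  then have eq: "ceval p s * ceval b s = ceval a s * ceval q s"
    by (metis ceval_mult)
  have b: "ceval b s \<noteq> 0"
  proof
    assume "ceval b s = 0"
    moreover from this have "ceval a s = 0"
      using eq q by simp
    ultimately show False
      using coprime_no_common_zero[OF ab(3)] by blast
  qed
  then show "rat_regular f s"
    by (simp add: rat_regular_def ab(1))
  show "rat_eval f s = ceval p s / ceval q s"
    using eq b q by (simp add: rat_eval_def ab(1) field_simps)
qed

lemma rat_regular_cases:
  assumes "rat_regular f s"
  obtains p q where "f = to_fract p / to_fract q" "q \<noteq> 0" "ceval q s \<noteq> 0"
    "rat_eval f s = ceval p s / ceval q s"
proof -
  obtain p q where pq: "quot_of_fract f = (p, q)" "q \<noteq> 0" "f = to_fract p / to_fract q"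
    by (rule ratfun_cases)
  then have "ceval q s \<noteq> 0"
    using assms by (simp add: rat_regular_def)
  then show ?thesis
    using that pq rat_eval_quotient by blast
qed

lemma rat_regular_add: "rat_regular f s \<Longrightarrow> rat_regular g s \<Longrightarrow> rat_regular (f + g) s"
  and rat_eval_add:
    "rat_regular f s \<Longrightarrow> rat_regular g s \<Longrightarrow> rat_eval (f + g) s = rat_eval f s + rat_eval g s"
proof -
  assume f: "rat_regular f s" and g: "rat_regular g s"
  obtain a b where ab: "f = to_fract a / to_fract b" "b \<noteq> 0" "ceval b s \<noteq> 0"
    "rat_eval f s = ceval a s / ceval b s"
    using rat_regular_cases[OF f] .
  obtain c d where cd: "g = to_fract c / to_fract d" "d \<noteq> 0" "ceval d s \<noteq> 0"
    "rat_eval g s = ceval c s / ceval d s"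
    using rat_regular_cases[OF g] .
  have 1: "f + g = to_fract (a * d + c * b) / to_fract (b * d)"
    using ab(2) cd(2) by (simp add: ab(1) cd(1) field_simps)
  have 2: "ceval (b * d) s \<noteq> 0"
    using ab(3) cd(3) by (simp add: ceval_mult)
  show "rat_regular (f + g) s"
    by (rule rat_eval_quotient(1)[OF 1 2])
  show "rat_eval (f + g) s = rat_eval f s + rat_eval g s"
    unfolding rat_eval_quotient(2)[OF 1 2] ab(4) cd(4) ceval_add ceval_mult
    using ab(3) cd(3) by (simp add: add_frac_eq)
qed

lemma rat_regular_mult: "rat_regular f s \<Longrightarrow> rat_regular g s \<Longrightarrow> rat_regular (f * g) s"
  and rat_eval_mult:
    "rat_regular f s \<Longrightarrow> rat_regular g s \<Longrightarrow> rat_eval (f * g) s = rat_eval f s * rat_eval g s"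
proof -
  assume f: "rat_regular f s" and g: "rat_regular g s"
  obtain a b where ab: "f = to_fract a / to_fract b" "ceval b s \<noteq> 0"
    "rat_eval f s = ceval a s / ceval b s"
    using rat_regular_cases[OF f] .
  obtain c d where cd: "g = to_fract c / to_fract d" "ceval d s \<noteq> 0"
    "rat_eval g s = ceval c s / ceval d s"
    using rat_regular_cases[OF g] .
  have 1: "f * g = to_fract (a * c) / to_fract (b * d)"
    by (simp add: ab(1) cd(1))
  have 2: "ceval (b * d) s \<noteq> 0"
    using ab(2) cd(2) by (simp add: ceval_mult)
  show "rat_regular (f * g) s"
    by (rule rat_eval_quotient(1)[OF 1 2])
  show "rat_eval (f * g) s = rat_eval f s * rat_eval g s"
    by (simp add: rat_eval_quotient(2)[OF 1 2] ab(3) cd(3) ceval_mult)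
qed

lemma rat_regular_const [simp]: "rat_regular (rat_const c) s"
  and rat_eval_const [simp]: "rat_eval (rat_const c) s = of_real c"
  using rat_eval_quotient[of "rat_const c" "[:c:]" 1 s]
  by (simp_all add: rat_const_def map_poly_pCons)

lemma rat_const_0: "rat_const 0 = 0" and rat_const_1: "rat_const 1 = 1"
  by (simp_all add: rat_const_def flip: one_pCons)

lemma rat_regular_0 [simp]: "rat_regular 0 s" and rat_eval_0 [simp]: "rat_eval 0 s = 0"
  using rat_regular_const[of 0 s] rat_eval_const[of 0 s] by (simp_all add: rat_const_0)

lemma rat_regular_1 [simp]: "rat_regular 1 s" and rat_eval_1 [simp]: "rat_eval 1 s = 1"
  using rat_regular_const[of 1 s] rat_eval_const[of 1 s] by (simp_all add: rat_const_1)

lemma rat_regular_diff: "rat_regular f s \<Longrightarrow> rat_regular g s \<Longrightarrow> rat_regular (f - g) s"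
proof -
  assume f: "rat_regular f s" and g: "rat_regular g s"
  have "rat_const (- 1) = - 1"
    by (simp add: rat_const_def flip: to_fract_uminus to_fract_1) (simp add: one_pCons)
  then have "f - g = f + rat_const (- 1) * g"
    by (simp only: mult_minus1 add_uminus_conv_diff)
  moreover have "rat_regular (f + rat_const (- 1) * g) s"
    by (intro rat_regular_add rat_regular_mult rat_regular_const f g)
  ultimately show ?thesis
    by (simp only:)
qed

lemma rat_regular_sum: "(\<And>i. i \<in> A \<Longrightarrow> rat_regular (f i) s) \<Longrightarrow> rat_regular (sum f A) s"
  by (induction A rule: infinite_finite_induct) (simp_all add: rat_regular_add)

lemma rat_eval_sum:
  "(\<And>i. i \<in> A \<Longrightarrow> rat_regular (f i) s) \<Longrightarrow> rat_eval (sum f A) s = (\<Sum>i\<in>A. rat_eval (f i) s)"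
  by (induction A rule: infinite_finite_induct)
    (simp_all add: rat_eval_add rat_regular_sum)

section \<open>Poles of rational functions\<close>

lemma eventually_ceval_nonzero:
  assumes "p \<noteq> 0"
  shows "\<forall>\<^sub>F z in at s. ceval p z \<noteq> 0"
proof -
  have "finite {z. ceval p z = 0}"
    using assms by (intro poly_roots_finite) (simp add: map_poly_of_real_eq_0_iff)
  from islimpt_finite[OF this, of s] show ?thesis
    by (simp add: islimpt_iff_eventually)
qed

lemma eventually_rat_regular: "\<forall>\<^sub>F z in at s. rat_regular f z"
  unfolding rat_regular_def
  by (rule eventually_ceval_nonzero) (rule snd_quot_of_fract_nonzero)

lemma eventually_rat_eval_nonzero:
  assumes "f \<noteq> 0"
  shows "\<forall>\<^sub>F z in at s. rat_eval f z \<noteq> 0"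
proof -
  obtain p q where pq: "quot_of_fract f = (p, q)" "q \<noteq> 0" "f = to_fract p / to_fract q"
    by (rule ratfun_cases)
  have "p \<noteq> 0"
    using assms pq(3) by auto
  show ?thesis
    using eventually_ceval_nonzero[OF \<open>p \<noteq> 0\<close>, of s] eventually_ceval_nonzero[OF \<open>q \<noteq> 0\<close>, of s]
    by eventually_elim (simp add: rat_eval_def pq(1))
qed

lemma is_pole_rat_eval_iff: "is_pole (rat_eval f) s \<longleftrightarrow> \<not> rat_regular f s"
proof -
  obtain p q where pq: "quot_of_fract f = (p, q)" "q \<noteq> 0" "coprime p q"
    by (rule ratfun_cases)
  have eval: "rat_eval f = (\<lambda>z. ceval p z / ceval q z)"
    by (simp add: rat_eval_def pq(1) fun_eq_iff)
  show ?thesis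
  proof (cases "ceval q s = 0")
    case True
    have "(ceval q \<longlongrightarrow> 0) (at s)"
      using True isContD[of s "ceval q"] by simp
    then have "filterlim (ceval q) (at 0) (at s)"
      by (simp add: filterlim_at eventually_ceval_nonzero pq(2))
    moreover have "ceval p s \<noteq> 0"
      using True coprime_no_common_zero[OF pq(3)] by blast
    ultimately have "is_pole (rat_eval f) s"
      unfolding eval by (intro is_pole_divide) simp_all
    then show ?thesis
      using True by (simp add: rat_regular_def pq(1))
  next
    case False
    then have "isCont (rat_eval f) s"
      unfolding eval by simp
    then have "\<not> is_pole (rat_eval f) s"
      unfolding is_pole_def
      using not_tendsto_and_filterlim_at_infinity[OF trivial_limit_at isContD] by blast
    then show ?thesis
      using False by (simp add: rat_regular_def pq(1))
  qed
qed

text \<open>Boundedness on points that merely accumulate at \<open>s\<close> already excludes a pole, because at a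
  pole a rational function is large on a full punctured neighbourhood.\<close>

lemma rat_regular_of_frequently_bounded:
  assumes "\<exists>\<^sub>F z in at s. norm (rat_eval f z) \<le> c"
  shows "rat_regular f s"
proof (rule ccontr)
  assume "\<not> rat_regular f s"
  then have "filterlim (rat_eval f) at_infinity (at s)"
    using is_pole_rat_eval_iff is_pole_def by blast
  then have "\<forall>\<^sub>F z in at s. max c 0 + 1 \<le> norm (rat_eval f z)"
    using filterlim_at_infinity[of 0 "rat_eval f"] by auto
  then have "\<forall>\<^sub>F z in at s. \<not> norm (rat_eval f z) \<le> c"
    by eventually_elim auto
  then show False
    using assms by (simp add: frequently_def)
qed

section \<open>Evaluation and poles of rational matrices\<close>

definition mat_regular :: "ratfun^'b^'a \<Rightarrow> complex \<Rightarrow> bool" where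
  "mat_regular G s \<longleftrightarrow> (\<forall>i j. rat_regular (G $ i $ j) s)"

lemma eval_mat_nth [simp]: "eval_mat G s $ i $ j = rat_eval (G $ i $ j) s"
  by (simp add: eval_mat_def map_matrix_def)

lemma mat_pole_iff: "mat_pole G s \<longleftrightarrow> \<not> mat_regular G s"
  by (simp add: mat_pole_def mat_regular_def is_pole_rat_eval_iff)

lemma eventually_mat_regular: "\<forall>\<^sub>F z in at s. mat_regular G z"
  unfolding mat_regular_def by (intro eventually_all_finite eventually_rat_regular)

lemma mat_regular_add: "mat_regular F s \<Longrightarrow> mat_regular G s \<Longrightarrow> mat_regular (F + G) s"
  by (simp add: mat_regular_def rat_regular_add)

lemma mat_regular_diff: "mat_regular F s \<Longrightarrow> mat_regular G s \<Longrightarrow> mat_regular (F - G) s"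
  by (simp add: mat_regular_def rat_regular_diff)

lemma mat_regular_mult: "mat_regular F s \<Longrightarrow> mat_regular G s \<Longrightarrow> mat_regular (F ** G) s"
  by (simp add: mat_regular_def matrix_matrix_mult_def rat_regular_sum rat_regular_mult)

lemma mat_regular_1 [simp]: "mat_regular (mat 1) s"
  by (simp add: mat_regular_def mat_def)

lemma mat_regular_const [simp]: "mat_regular (const_mat M) s"
  by (simp add: mat_regular_def const_mat_def map_matrix_def)

lemma eval_mat_add:
  "mat_regular F s \<Longrightarrow> mat_regular G s \<Longrightarrow> eval_mat (F + G) s = eval_mat F s + eval_mat G s"
  by (simp add: vec_eq_iff mat_regular_def rat_eval_add)

lemma eval_mat_mult:
  "mat_regular F s \<Longrightarrow> mat_regular G s \<Longrightarrow> eval_mat (F ** G) s = eval_mat F s ** eval_mat G s"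
  by (simp add: vec_eq_iff mat_regular_def matrix_matrix_mult_def rat_eval_sum rat_regular_mult
      rat_eval_mult)

lemma eval_mat_1 [simp]: "eval_mat (mat 1) s = mat 1"
  by (simp add: vec_eq_iff mat_def)

lemma eval_mat_vector_mult:
  fixes v :: "ratfun^'b"
  assumes "mat_regular F s" "\<And>j. rat_regular (v $ j) s"
  shows "eval_mat F s *v (\<chi> j. rat_eval (v $ j) s) = (\<chi> i. rat_eval ((F *v v) $ i) s)"
  using assms
  by (simp add: vec_eq_iff mat_regular_def matrix_vector_mult_def rat_eval_sum rat_regular_mult
      rat_eval_mult)

section \<open>Coercive matrices\<close>

text \<open>The inner product \<open>\<bullet>\<close> on \<open>complex^'k\<close> is the real part of the Hermitian form. Numerical ranges in a right half plane are expressed through it.\<close>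

lemma inner_eq_Re_sum: "x \<bullet> y = Re (\<Sum>i\<in>UNIV. cnj (x $ i) * y $ i)" for x y :: "complex^'k"
  by (simp add: inner_vec_def inner_complex_def)

lemma inner_conj_transpose: "x \<bullet> (conj_transpose M *v y) = (M *v x) \<bullet> y"
  for x :: "complex^'k" and y :: "complex^'l"
proof -
  have "(\<Sum>i\<in>UNIV. cnj (x $ i) * (conj_transpose M *v y) $ i)
      = (\<Sum>i\<in>UNIV. \<Sum>j\<in>UNIV. cnj (x $ i) * (cnj (M $ j $ i) * y $ j))"
    by (simp add: conj_transpose_def map_matrix_def transpose_def matrix_vector_mult_def
        sum_distrib_left)
  also have "\<dots> = (\<Sum>j\<in>UNIV. \<Sum>i\<in>UNIV. cnj (x $ i) * (cnj (M $ j $ i) * y $ j))"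
    by (rule sum.swap)
  also have "\<dots> = (\<Sum>j\<in>UNIV. cnj ((M *v x) $ j) * y $ j)"
    by (simp add: matrix_vector_mult_def sum_distrib_left mult_ac)
  finally show ?thesis
    by (simp add: inner_eq_Re_sum)
qed

lemma inner_Re_mat: "x \<bullet> (Re_mat M *v x) = x \<bullet> (M *v x)"
proof -
  have "Re_mat M *v x = (1/2) *\<^sub>R (M *v x + conj_transpose M *v x)"
    by (simp add: Re_mat_def vec_eq_iff matrix_vector_mult_def scaleR_sum_right sum.distrib
        scaleR_add_right distrib_right)
  then show ?thesis
    by (simp add: inner_add_right inner_conj_transpose inner_commute)
qed

lemma pos_semidef_Re_mat_inner:
  "pos_semidef (Re_mat M) \<Longrightarrow> 0 \<le> x \<bullet> (M *v x)"
  unfolding pos_semidef_def inner_eq_Re_sum[symmetric] by (simp add: inner_Re_mat)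

definition coercive :: "complex^'k^'k \<Rightarrow> bool" where
  "coercive M \<longleftrightarrow> (\<forall>x. x \<bullet> x \<le> x \<bullet> (M *v x))"

lemma coercive_norm_le:
  assumes "coercive M"
  shows "norm x \<le> norm (M *v x)"
proof (cases "x = 0")
  case False
  have "norm x * norm x = x \<bullet> x"
    by (simp add: power2_norm_eq_inner flip: power2_eq_square)
  also have "\<dots> \<le> x \<bullet> (M *v x)"
    using assms by (simp add: coercive_def)
  also have "\<dots> \<le> norm x * norm (M *v x)"
    by (rule norm_cauchy_schwarz)
  finally show ?thesis
    using False by simp
qed simp

text \<open>A column of the inverse is mapped by \<open>M\<close> to a unit vector and therefore has norm at most one.\<close>

lemma coercive_right_inverse_entry_le:
  fixes M N :: "complex^'k^'k"
  assumes "coercive M" "M ** N = mat 1"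
  shows "norm (N $ i $ j) \<le> 1"
proof -
  have "norm (N $ i $ j) = norm ((N *v axis j 1) $ i)"
    by (simp add: matrix_vector_mult_def axis_def if_distrib[where f = "\<lambda>t. _ * t"] cong: if_cong)
  also have "\<dots> \<le> norm (N *v axis j 1)"
    by (rule Finite_Cartesian_Product.norm_nth_le)
  also have "\<dots> \<le> norm (M *v (N *v axis j 1))"
    by (rule coercive_norm_le[OF assms(1)])
  also have "\<dots> = norm (axis j 1 :: complex^_)"
    by (simp add: matrix_vector_mul_assoc assms(2))
  also have "\<dots> = 1"
    by simp
  finally show ?thesis .
qed

text \<open>A congruence by a real diagonal matrix preserves nonnegativity of the numerical range, and
  adding the identity makes it coercive with constant one.\<close>

lemma coercive_one_plus_diag_congruence:
  fixes M :: "complex^'k^'k" and d :: "real^'k"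
  assumes "\<And>x. 0 \<le> x \<bullet> (M *v x)"
  defines "D \<equiv> diag (\<chi> i. complex_of_real (d $ i))"
  shows "coercive (mat 1 + D ** M ** D)"
  unfolding coercive_def
proof
  fix x :: "complex^'k"
  have D: "(D *v y) $ i = of_real (d $ i) * y $ i" for y :: "complex^'k" and i
    by (simp add: D_def diag_def matrix_vector_mult_def if_distrib[where f = "\<lambda>t. t * _"] cong: if_cong)
  have D_sym: "y \<bullet> (D *v z) = (D *v y) \<bullet> z" for y z :: "complex^'k"
    by (simp add: inner_eq_Re_sum D mult_ac)
  have "x \<bullet> ((D ** M ** D) *v x) = (D *v x) \<bullet> (M *v (D *v x))"
    by (simp add: D_sym flip: matrix_vector_mul_assoc)
  then show "x \<bullet> x \<le> x \<bullet> ((mat 1 + D ** M ** D) *v x)"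
    using assms(1)[of "D *v x"] by (simp add: matrix_vector_mult_add_rdistrib inner_add_right)
qed

section \<open>Inverses of coercive rational matrices\<close>

text \<open>A rational kernel vector can be evaluated at a nearby point where \<open>F\<close> is coercive, hence
  injective, and where one of its nonzero entries keeps a nonzero value.\<close>

lemma invertible_of_frequently_coercive:
  fixes F :: "ratfun^'k^'k"
  assumes "\<exists>\<^sub>F z in at s. coercive (eval_mat F z)"
  shows "invertible F"
proof -
  have "v = 0" if Fv: "F *v v = 0" for v :: "ratfun^'k"
  proof (rule ccontr)
    assume "v \<noteq> 0"
    then obtain i where i: "v $ i \<noteq> 0"
      by (auto simp: vec_eq_iff)
    have "\<forall>\<^sub>F z in at s. mat_regular F z \<and> (\<forall>j. rat_regular (v $ j) z) \<and> rat_eval (v $ i) z \<noteq> 0"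
      by (intro eventually_conj eventually_mat_regular eventually_all_finite
          eventually_rat_regular eventually_rat_eval_nonzero i)
    from frequently_eventually_conj[OF assms this]
    obtain z where z: "coercive (eval_mat F z)" "mat_regular F z"
      "\<And>j. rat_regular (v $ j) z" "rat_eval (v $ i) z \<noteq> 0"
      by (auto dest!: frequently_ex)
    let ?v = "\<chi> j. rat_eval (v $ j) z"
    have "eval_mat F z *v ?v = 0"
      by (simp add: eval_mat_vector_mult z Fv vec_eq_iff)
    then have "?v = 0"
      using coercive_norm_le[OF z(1), of ?v] by simp
    then show False
      using z(4) by (simp add: vec_eq_iff)
  qed
  then show ?thesis
    by (simp add: invertible_left_inverse matrix_left_invertible_ker)
qed

text \<open>At the coercive points the inverse has entries of modulus at most one, which rules out a pole
  of the inverse at their accumulation point \<open>s\<close>, whether or not \<open>F\<close> itself has a pole there.\<close>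

lemma mat_regular_matrix_inv:
  fixes F :: "ratfun^'k^'k"
  assumes "\<exists>\<^sub>F z in at s. coercive (eval_mat F z)"
  shows "mat_regular (matrix_inv F) s"
  unfolding mat_regular_def
proof (intro allI)
  fix i j
  let ?G = "matrix_inv F"
  have FG: "F ** ?G = mat 1"
    using invertible_of_frequently_coercive[OF assms] unfolding invertible_def matrix_inv_def
    by (rule someI2_ex) simp
  have "\<forall>\<^sub>F z in at s. mat_regular F z \<and> mat_regular ?G z"
    by (intro eventually_conj eventually_mat_regular)
  from frequently_eventually_conj[OF assms this]
  have "\<exists>\<^sub>F z in at s. norm (rat_eval (?G $ i $ j) z) \<le> 1"
  proof (rule frequently_elim1)
    fix z
    assume z: "(mat_regular F z \<and> mat_regular ?G z) \<and> coercive (eval_mat F z)"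
    then have "eval_mat F z ** eval_mat ?G z = mat 1"
      using FG by (metis eval_mat_mult eval_mat_1)
    then show "norm (rat_eval (?G $ i $ j) z) \<le> 1"
      using coercive_right_inverse_entry_le[of "eval_mat F z" "eval_mat ?G z" i j] z by simp
  qed
  then show "rat_regular (?G $ i $ j) s"
    by (rule rat_regular_of_frequently_bounded)
qed

section \<open>Parametric models with a positive real feedback subsystem\<close>

lemma coercive_feedback:
  assumes "positive_real G" "0 \<le> Re z" "mat_regular G z"
  shows "coercive (eval_mat (mat 1 + D_mat p ** G ** D_mat p) z)"
proof -
  have "eval_mat (D_mat p) z = diag (\<chi> i. complex_of_real ((\<chi> i. sqrt (p $ i)) $ i))"
    by (simp add: vec_eq_iff D_mat_def const_mat_def map_matrix_def diag_def)
  moreover have "0 \<le> x \<bullet> (eval_mat G z *v x)" for x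
    using assms by (intro pos_semidef_Re_mat_inner) (simp add: positive_real_def mat_pole_iff)
  ultimately show ?thesis
    using coercive_one_plus_diag_congruence[of "eval_mat G z" "\<chi> i. sqrt (p $ i)"] assms(3)
    by (simp add: eval_mat_add eval_mat_mult mat_regular_mult D_mat_def)
qed

text \<open>Every punctured neighbourhood of a point on the imaginary axis contains points of the left half
  plane, where positive realness says nothing; so the inequality is obtained frequently, and not
  eventually, near \<open>s\<close>.\<close>

lemma frequently_coercive_feedback:
  assumes "positive_real G" "0 \<le> Re s"
  shows "\<exists>\<^sub>F z in at s. coercive (eval_mat (mat 1 + D_mat p ** G ** D_mat p) z)"
proof -
  have "\<exists>\<^sub>F z in at s. 0 \<le> Re z"
    unfolding frequently_at
  proof (intro allI impI)
    fix e :: real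
    assume "e > 0"
    then show "\<exists>z\<in>UNIV. z \<noteq> s \<and> dist z s < e \<and> 0 \<le> Re z"
      using assms(2)
      by (intro bexI[of _ "s + of_real (e / 2)"]) (auto simp: dist_norm)
  qed
  from frequently_eventually_conj[OF this eventually_mat_regular[of G s]]
  show ?thesis
    by (rule frequently_elim1) (auto intro: coercive_feedback assms(1))
qed

lemma asymptotically_stable_parametric_model:
  assumes "asymptotically_stable H1" "asymptotically_stable H2" "asymptotically_stable H4"
    and "positive_real H3"
  shows "asymptotically_stable (parametric_model H1 H2 H3 H4 p)"
  unfolding asymptotically_stable_def
proof (intro allI impI)
  fix s
  assume pole: "mat_pole (parametric_model H1 H2 H3 H4 p) s"
  show "Re s < 0"
  proof (rule ccontr)
    assume "\<not> Re s < 0"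
    then have s: "0 \<le> Re s"
      by simp
    have "mat_regular H1 s" "mat_regular H2 s" "mat_regular H4 s"
      using assms s by (auto simp: asymptotically_stable_def mat_pole_iff not_le[symmetric])
    moreover have "mat_regular (matrix_inv (mat 1 + D_mat p ** H3 ** D_mat p)) s"
      by (intro mat_regular_matrix_inv frequently_coercive_feedback assms(4) s)
    moreover have "mat_regular (D_mat p) s"
      by (simp add: D_mat_def)
    ultimately have "mat_regular (parametric_model H1 H2 H3 H4 p) s"
      unfolding parametric_model_def by (intro mat_regular_diff mat_regular_mult)
    then show False
      using pole by (simp add: mat_pole_iff)
  qed
qed

theorem theorem2:
  fixes E A0 :: "real^'n^'n" and B :: "real^'m^'n" and C :: "real^'n^'l"
    and U V :: "real^'k^'n" and \<Omega> :: "(real^'k) set"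
    and H :: "real^'k \<Rightarrow> ratfun^'m^'l"
    and H1 :: "ratfun^'m^'l" and H2 :: "ratfun^'k^'l"
    and H3 :: "ratfun^'k^'k" and H4 :: "ratfun^'m^'k"
    and Hr1 :: "ratfun^'m^'l" and Hr2 :: "ratfun^'k^'l"
    and Hr3 :: "ratfun^'k^'k" and Hr4 :: "ratfun^'m^'k"
  assumes "invertible E"
    and "\<And>p i. p \<in> \<Omega> \<Longrightarrow> 0 \<le> p $ i"
    and "H1 = transfer_function C E A0 B"
    and "H2 = transfer_function C E A0 U"
    and "H3 = transfer_function (transpose V) E A0 U"
    and "H4 = transfer_function (transpose V) E A0 B"
    and "\<And>p. p \<in> \<Omega> \<Longrightarrow> H p = parametric_model H1 H2 H3 H4 p"
    and "asymptotically_stable H1" and "asymptotically_stable H2"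
    and "asymptotically_stable H4" and "positive_real H3"
    and "proper_mat Hr1" and "proper_mat Hr2" and "proper_mat Hr3" and "proper_mat Hr4"
    and "asymptotically_stable Hr1" and "asymptotically_stable Hr2"
    and "asymptotically_stable Hr4" and "positive_real Hr3"
  shows "uniformly_asymptotically_stable \<Omega> (parametric_model Hr1 Hr2 Hr3 Hr4)"
  unfolding uniformly_asymptotically_stable_def
  using assms(16-19) by (blast intro: asymptotically_stable_parametric_model)

end
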